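(* Let $(i,k,\ell)\in\mathbb{X}$ and $(i,k+1,\ell-1)\in\mathbb{X}$ with $i\ge1$. 1. When a Station 1 (independent service) job finishes first (with $k\ge1$): if it is optimal to choose collaborative service at $(i,k,\ell)$, then it is optimal to choose collaborative service at $(i,k+1,\ell-1)$. 2. When a Station 2 (collaborative service) job finishes first (with $\ell-1\ge1$): if it is optimal to choose collaborative service at $(i,k,\ell)$, then it is optimal to choose collaborative service at $(i,k+1,\ell-1)$.
   Context: Let $C_1,C_2\ge1$ be integers with $C_2<C_1$ (numbers of Type-I and Type-II servers), $\mu_1,\mu_2>0$ (service rates at Station 1, the independent service station, and Station 2, the collaborative service station) and $h_0,h_1,h_2>0$ (holding costs per job per unit time in the initial queue, at Station 1 and at Station 2). Write $\mathbb{Z}_+=\{0,1,2,\dots\}$. The state space is $$\mathbb{X}=\{(i,k,\ell)\in\mathbb{Z}_+^3 : (i=0 \text{ and } k+\ell<C_1)\text{ or }(i\ge0\text{ and }k+\ell=C_1)\},$$ where $i$ is the number of jobs in the initial queue, $k$ the number of jobs in service at Station 1 and $\ell$ the number of jobs at Station 2 (in service or waiting there). There are no arrivals. Service is non-preemptive with exponential times: Station 1 completes services at total rate $k\mu_1$ and Station 2 at total rate $\min\{\ell,C_2\}\mu_2$; put $d(k,\ell)=k\mu_1+\min\{\ell,C_2\}\mu_2$. Decisions: in a state $(i,k,\ell)$ with $i\ge1$, when a service completes the freed Type-I server takes the next queued job and chooses independent service (Station 1) or collaborative service (Station 2). If a Station 1 job is completed first, the next state is $(i-1,k,\ell)$ under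 independent and $(i-1,k-1,\ell+1)$ under collaborative service. If a Station 2 job is completed first, the next state is $(i-1,k+1,\ell-1)$ under independent and $(i-1,k,\ell)$ under collaborative service. The value function $v:\mathbb{X}\to\mathbb{R}$ is the minimal expected total holding cost until the system is empty. It satisfies $v(0,0,0)=0$, $$v(0,k,\ell)=\tfrac{kh_1+\ell h_2}{d(k,\ell)}+\tfrac{k\mu_1}{d(k,\ell)}v(0,k-1,\ell)+\tfrac{\min\{\ell,C_2\}\mu_2}{d(k,\ell)}v(0,k,\ell-1)\quad ((k,\ell)\ne(0,0)),$$ and for $i\ge1$, $$v(i,k,\ell)=\tfrac{ih_0+kh_1+\ell h_2}{d(k,\ell)}+\tfrac{k\mu_1}{d(k,\ell)}\min\{v(i-1,k,\ell),v(i-1,k-1,\ell+1)\}+\tfrac{\min\{\ell,C_2\}\mu_2}{d(k,\ell)}\min\{v(i-1,k+1,\ell-1),v(i-1,k,\ell)\},$$ where terms with coefficient $0$ are read as $0$. A decision is optimal if the state it leads to attains the corresponding minimum. *)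

theory Defs
  imports "HOL-Probability.Probability"
begin

text \<open>
  A state \<open>(i, k, l)\<close> records the jobs in the initial queue, in service at Station 1, and
  at Station 2 (in service or waiting).
\<close>

type_synonym state = "nat \<times> nat \<times> nat"

datatype station = Station1 | Station2

datatype decision = Independent | Collaborative

definition state_space :: "nat \<Rightarrow> state set" where
  "state_space C1 = {(i, k, l). (i = 0 \<and> k + l < C1) \<or> (i \<ge> 0 \<and> k + l = C1)}"

text \<open>
  The state reached from \<open>s\<close> when a job at station \<open>f\<close> finishes first and decision \<open>a\<close> is
  taken. With an empty queue nothing is decided and \<open>a\<close> is ignored. The truncated
  subtractions on \<open>k\<close> and \<open>l\<close> are harmless, because a completion at an empty station
  has probability \<open>0\<close>.
\<close>

fun next_state :: "state \<Rightarrow> station \<Rightarrow> decision \<Rightarrow> state" where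
  "next_state (0, k, l) Station1 a = (0, k - 1, l)"
| "next_state (0, k, l) Station2 a = (0, k, l - 1)"
| "next_state (Suc i, k, l) Station1 Independent = (i, k, l)"
| "next_state (Suc i, k, l) Station1 Collaborative = (i, k - 1, l + 1)"
| "next_state (Suc i, k, l) Station2 Independent = (i, k + 1, l - 1)"
| "next_state (Suc i, k, l) Station2 Collaborative = (i, k, l)"

text \<open>
  A policy decides on the basis of everything that has happened so far: the list, most recent
  entry first, of the states occupied and of the station at which the job finished that ended
  the stay there. The head of the list is the present decision epoch.
\<close>

type_synonym history = "(state \<times> station) list"

type_synonym policy = "history \<Rightarrow> decision"

context
  fixes C2 :: nat and mu1 mu2 h0 h1 h2 :: real
begin

definition service_rate :: "nat \<Rightarrow> nat \<Rightarrow> real" where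
  "service_rate k l = real k * mu1 + real (min l C2) * mu2"

definition holding_rate :: "state \<Rightarrow> real" where
  "holding_rate = (\<lambda>(i, k, l). real i * h0 + real k * h1 + real l * h2)"

text \<open>
  Expected holding cost of one stay in a state, whose duration is exponential with the total
  service rate. In the empty system the density is identically \<open>0\<close>, and so is the cost.
\<close>

definition stay_cost :: "state \<Rightarrow> real" where
  "stay_cost = (\<lambda>(i, k, l).
     \<integral>t. holding_rate (i, k, l) * t \<partial>density lborel (exponential_density (service_rate k l)))"

definition first_completion :: "state \<Rightarrow> station pmf" where
  "first_completion = (\<lambda>(i, k, l).
     map_pmf (\<lambda>b. if b then Station1 else Station2)
       (bernoulli_pmf (real k * mu1 / service_rate k l)))"

definition jump_step :: "policy \<Rightarrow> history \<times> state \<Rightarrow> (history \<times> state) pmf" where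
  "jump_step \<pi> = (\<lambda>(h, s).
     if s = (0, 0, 0) then return_pmf (h, s)
     else map_pmf (\<lambda>f. let h' = (s, f) # h in (h', next_state s f (\<pi> h')))
            (first_completion s))"

text \<open>Law of the history and the state after \<open>n\<close> service completions.\<close>

primrec jump_chain :: "policy \<Rightarrow> history \<times> state \<Rightarrow> nat \<Rightarrow> (history \<times> state) pmf" where
  "jump_chain \<pi> hs 0 = return_pmf hs"
| "jump_chain \<pi> hs (Suc n) = bind_pmf (jump_chain \<pi> hs n) (jump_step \<pi>)"

text \<open>
  Given the jump chain the stays are independent and policies do not depend on their lengths, so
  the expectation of the integral over time of the holding rate is the sum over the stays of
  the expected \<open>stay_cost\<close>. From a state in the state space the system is empty after
  \<open>i + k + l\<close> completions, so only finitely many terms are nonzero.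
\<close>

definition cost_from :: "policy \<Rightarrow> history \<times> state \<Rightarrow> real" where
  "cost_from \<pi> hs =
     (\<Sum>n. measure_pmf.expectation (jump_chain \<pi> hs n) (\<lambda>(h, s). stay_cost s))"

definition total_cost :: "policy \<Rightarrow> state \<Rightarrow> real" where
  "total_cost \<pi> s = cost_from \<pi> ([], s)"

definition value_fn :: "state \<Rightarrow> real" where
  "value_fn s = (INF \<pi>. total_cost \<pi> s)"

definition optimal_decision :: "state \<Rightarrow> station \<Rightarrow> decision \<Rightarrow> bool" where
  "optimal_decision s f a \<longleftrightarrow>
     value_fn (next_state s f a) = min (value_fn (next_state s f Independent)) (value_fn (next_state s f Collaborative))"

end

text \<open>
  The infimum defining \<open>value_fn\<close> is attained and \<open>value_fn\<close> satisfies the optimality equations.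
\<close>

context
  fixes C1 C2 :: nat and mu1 mu2 h0 h1 h2 :: real
  assumes C2: "C2 \<ge> 1" and mu1: "mu1 > 0" and mu2: "mu2 > 0"
    and h0: "h0 > 0" and h1: "h1 > 0" and h2: "h2 > 0" and C1: "C1 \<ge> 1"
begin

private abbreviation (input) "d \<equiv> service_rate C2 mu1 mu2"
private abbreviation (input) "val \<equiv> value_fn C2 mu1 mu2 h0 h1 h2"
private abbreviation (input) "scost \<equiv> stay_cost C2 mu1 mu2 h0 h1 h2"
private abbreviation (input) "chain \<equiv> jump_chain C2 mu1 mu2"
private abbreviation (input) "stp \<equiv> jump_step C2 mu1 mu2"
private abbreviation (input) "cost \<equiv> cost_from C2 mu1 mu2 h0 h1 h2"

private definition prb :: "state \<Rightarrow> station \<Rightarrow> real" where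
  "prb = (\<lambda>(i, k, l) f. case f of
     Station1 \<Rightarrow> real k * mu1 / d k l | Station2 \<Rightarrow> real (min l C2) * mu2 / d k l)"

private definition jobs :: "state \<Rightarrow> nat" where "jobs = (\<lambda>(i, k, l). i + k + l)"

private lemma d_pos: "k + l > 0 \<Longrightarrow> d k l > 0"
proof -
  assume a: "k + l > 0"
  show ?thesis
  proof (cases "k = 0")
    case True
    then have "real (min l C2) > 0" using a C2 by auto
    then show ?thesis using True mu2 by (simp add: service_rate_def)
  next
    case False
    then have "real k * mu1 > 0" using mu1 by simp
    moreover have "real (min l C2) * mu2 \<ge> 0" using mu2 by simp
    ultimately show ?thesis unfolding service_rate_def by linarith
  qed
qed

private lemma space_pos:
  "(i, k, l) \<in> state_space C1 \<Longrightarrow> (i, k, l) \<noteq> (0, 0, 0) \<Longrightarrow> k + l > 0"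
  using C1 by (auto simp: state_space_def)

private lemma stay_cost_eq:
  assumes "k + l > 0"
  shows "scost (i, k, l) = (real i * h0 + real k * h1 + real l * h2) / d k l"
proof -
  let ?M = "density lborel (exponential_density (d k l))"
  note pos = d_pos[OF assms]
  interpret prob_space ?M by (rule prob_space_exponential_density[OF pos])
  have "distributed ?M lborel (\<lambda>x. x) (exponential_density (d k l))"
    by (auto simp: distributed_def intro!: distr_id2)
  from exponential_distributed_expectation[OF pos this]
  have "(\<integral>t. t \<partial>?M) = 1 / d k l" by simp
  then show ?thesis by (simp add: stay_cost_def holding_rate_def)
qed

private lemma stay_cost_empty: "scost (0, 0, 0) = 0"
  by (simp add: stay_cost_def holding_rate_def)

private lemma prb_sum: "k + l > 0 \<Longrightarrow> prb (i, k, l) Station1 + prb (i, k, l) Station2 = 1"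
  using d_pos[of k l] by (simp add: prb_def service_rate_def add_divide_distrib[symmetric])

private lemma prb_nonneg: "k + l > 0 \<Longrightarrow> prb (i, k, l) f \<ge> 0"
  using d_pos[of k l] mu1 mu2 by (cases f) (auto simp: prb_def)

private lemma next_in:
  assumes "s \<in> state_space C1" "s \<noteq> (0, 0, 0)" "prb s f \<noteq> 0"
  shows "next_state s f a \<in> state_space C1" "jobs s = Suc (jobs (next_state s f a))"
  using assms
  by (cases s; cases "fst s"; cases f; cases a; force simp: state_space_def jobs_def prb_def)+

private lemma E_first:
  assumes "k + l > 0"
  shows "measure_pmf.expectation (first_completion C2 mu1 mu2 (i, k, l)) g
       = prb (i, k, l) Station1 * g Station1 + prb (i, k, l) Station2 * (g Station2 :: real)"
proof -
  let ?p = "prb (i, k, l) Station1"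
  have p: "0 \<le> ?p" "?p \<le> 1" "1 - ?p = prb (i, k, l) Station2"
    using prb_sum[OF assms, of i] prb_nonneg[OF assms, of i Station1]
      prb_nonneg[OF assms, of i Station2] by linarith+
  have "first_completion C2 mu1 mu2 (i, k, l)
      = map_pmf (\<lambda>b. if b then Station1 else Station2) (bernoulli_pmf ?p)"
    by (simp add: first_completion_def prb_def)
  then show ?thesis using p by (simp add: mult.commute)
qed

private lemma set_first:
  assumes "k + l > 0"
  shows "set_pmf (first_completion C2 mu1 mu2 (i, k, l)) = {f. prb (i, k, l) f \<noteq> 0}"
proof -
  let ?M = "first_completion C2 mu1 mu2 (i, k, l)"
  have "pmf ?M f = prb (i, k, l) f" for f
  proof -
    have "pmf ?M f = measure_pmf.expectation ?M (indicator {f})"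
      by (simp add: measure_pmf_single)
    also have "\<dots> = prb (i, k, l) f" by (subst E_first[OF assms]) (cases f; simp)
    finally show ?thesis .
  qed
  then show ?thesis by (simp add: set_pmf_eq)
qed

private lemma finite_station: "finite (A :: station set)"
  by (rule finite_subset[of _ "{Station1, Station2}"]) (auto intro: station.exhaust)

private lemma finite_step: "finite (set_pmf (stp \<pi> hs))"
  by (auto simp: jump_step_def finite_station split: prod.split)

private lemma finite_chain: "finite (set_pmf (chain \<pi> hs n))"
  by (induction n) (auto simp: finite_step)

private lemma chain_Suc': "chain \<pi> hs (Suc n) = bind_pmf (stp \<pi> hs) (\<lambda>x. chain \<pi> x n)"
proof (induction n)
  case 0
  then show ?case by (simp add: bind_return_pmf bind_return_pmf')
next
  case (Suc n)
  then show ?case by (simp add: bind_assoc_pmf)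
qed

private lemma step_in:
  assumes "s \<in> state_space C1" "s \<noteq> (0, 0, 0)" "x \<in> set_pmf (stp \<pi> (h, s))"
  shows "snd x \<in> state_space C1 \<and> jobs s = Suc (jobs (snd x))"
proof -
  obtain i k l where s: "s = (i, k, l)" by (cases s)
  have "k + l > 0" using space_pos assms s by blast
  from set_first[OF this, of i] show ?thesis
    using assms next_in[OF assms(1,2)] by (auto simp: jump_step_def Let_def s)
qed

private lemma chain_empty:
  "s \<in> state_space C1 \<Longrightarrow> jobs s \<le> n \<Longrightarrow> x \<in> set_pmf (chain \<pi> (h, s) n) \<Longrightarrow> snd x = (0, 0, 0)"
proof (induction n arbitrary: h s)
  case 0
  then show ?case by (cases s) (auto simp: jobs_def)
next
  case (Suc n)
  show ?case
  proof (cases "s = (0, 0, 0)")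
    case True
    then have "stp \<pi> (h, s) = return_pmf (h, s)" by (simp add: jump_step_def)
    then have "x \<in> set_pmf (chain \<pi> (h, s) n)"
      using Suc.prems by (simp only: chain_Suc' bind_return_pmf)
    then show ?thesis using Suc.IH[of s h] Suc.prems True by (simp add: jobs_def)
  next
    case False
    from Suc.prems(3) obtain y where y: "y \<in> set_pmf (stp \<pi> (h, s))"
      "x \<in> set_pmf (chain \<pi> y n)" by (auto simp only: chain_Suc' set_bind_pmf)
    from step_in[OF Suc.prems(1) False y(1)] Suc.prems(2)
    show ?thesis using Suc.IH[of "snd y" "fst y"] y(2) by simp
  qed
qed

private lemma cost_sum:
  assumes "s \<in> state_space C1" "jobs s \<le> N"
  shows "cost \<pi> (h, s)
       = (\<Sum>n<N. measure_pmf.expectation (chain \<pi> (h, s) n) (\<lambda>(h, s). scost s))"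
  unfolding cost_from_def
proof (rule suminf_finite)
  fix n assume "n \<notin> {..<N}"
  then have *: "jobs s \<le> n" using assms by simp
  have "measure_pmf.expectation (chain \<pi> (h, s) n) (\<lambda>(h, s). scost s)
      = measure_pmf.expectation (chain \<pi> (h, s) n) (\<lambda>x. 0 :: real)"
    by (intro integral_cong_AE)
       (auto simp: AE_measure_pmf_iff stay_cost_empty dest!: chain_empty[OF assms(1) *])
  then show "measure_pmf.expectation (chain \<pi> (h, s) n) (\<lambda>(h, s). scost s) = 0" by simp
qed auto

private lemma cost_empty: "cost \<pi> (h, 0, 0, 0) = 0"
  using cost_sum[of "(0, 0, 0)" 0 \<pi> h] C1 by (auto simp: state_space_def jobs_def)

private lemma cost_step:
  assumes s: "s \<in> state_space C1" "s \<noteq> (0, 0, 0)"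
  shows "cost \<pi> (h, s) = scost s
    + prb s Station1 * cost \<pi> ((s, Station1) # h, next_state s Station1 (\<pi> ((s, Station1) # h)))
    + prb s Station2 * cost \<pi> ((s, Station2) # h, next_state s Station2 (\<pi> ((s, Station2) # h)))"
proof -
  obtain i k l where ikl: "s = (i, k, l)" by (cases s)
  have kl: "k + l > 0" using space_pos s ikl by blast
  define e where "e x n = measure_pmf.expectation (chain \<pi> x n) (\<lambda>(h, s). scost s)" for x n
  define nx where "nx f = ((s, f) # h, next_state s f (\<pi> ((s, f) # h)))" for f
  have st: "stp \<pi> (h, s) = map_pmf nx (first_completion C2 mu1 mu2 s)"
    using s by (simp add: jump_step_def nx_def[abs_def] Let_def)
  have rec: "e (h, s) (Suc n) = prb s Station1 * e (nx Station1) n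
      + prb s Station2 * e (nx Station2) n" for n
  proof -
    have "e (h, s) (Suc n) = measure_pmf.expectation (stp \<pi> (h, s)) (\<lambda>x. e x n)"
      unfolding e_def chain_Suc'
      by (subst pmf_expectation_bind[OF finite_step finite_chain order_refl])
         (simp add: integral_measure_pmf_real[OF finite_step] mult.commute)
    then show ?thesis by (simp add: st E_first[OF kl, of i, folded ikl])
  qed
  obtain N where N: "jobs s = Suc N" using kl by (cases "jobs s") (auto simp: ikl jobs_def)
  have c: "prb s f * cost \<pi> (nx f) = prb s f * (\<Sum>n<N. e (nx f) n)" for f
  proof (cases "prb s f = 0")
    case False
    from next_in[OF s False] N show ?thesis unfolding nx_def e_def
      by (subst cost_sum[of _ N]) auto
  qed simp
  have "cost \<pi> (h, s) = (\<Sum>n<Suc N. e (h, s) n)"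
    unfolding e_def by (rule cost_sum[OF s(1)]) (simp add: N)
  also have "\<dots> = e (h, s) 0 + (\<Sum>n<N. e (h, s) (Suc n))" by (rule sum.lessThan_Suc_shift)
  also have "e (h, s) 0 = scost s" by (simp add: e_def)
  also have "(\<Sum>n<N. e (h, s) (Suc n))
      = prb s Station1 * cost \<pi> (nx Station1) + prb s Station2 * cost \<pi> (nx Station2)"
    by (simp only: rec c sum.distrib sum_distrib_left)
  finally show ?thesis by (simp add: nx_def)
qed

private primrec W :: "nat \<Rightarrow> state \<Rightarrow> real" where
  "W 0 s = 0"
| "W (Suc n) s = scost s
    + prb s Station1 * min (W n (next_state s Station1 Independent)) (W n (next_state s Station1 Collaborative))
    + prb s Station2 * min (W n (next_state s Station2 Independent)) (W n (next_state s Station2 Collaborative))"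

private definition greedy :: policy where
  "greedy h = (case h of [] \<Rightarrow> Independent | (s, f) # _ \<Rightarrow>
     if W (jobs s - 1) (next_state s f Collaborative) \<le> W (jobs s - 1) (next_state s f Independent)
     then Collaborative else Independent)"

private lemma jobs_0: "jobs s = 0 \<longleftrightarrow> s = (0, 0, 0)"
  by (cases s) (auto simp: jobs_def)

private lemma cost_lower: "s \<in> state_space C1 \<Longrightarrow> jobs s = n \<Longrightarrow> W n s \<le> cost \<pi> (h, s)"
proof (induction n arbitrary: h s)
  case 0
  then show ?case using cost_empty by (simp add: jobs_0)
next
  case (Suc n)
  then have s: "s \<noteq> (0, 0, 0)" by (auto simp: jobs_def)
  obtain i k l where ikl: "s = (i, k, l)" by (cases s)
  have kl: "k + l > 0" using space_pos Suc.prems(1) s ikl by blast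
  have "prb s f * min (W n (next_state s f Independent)) (W n (next_state s f Collaborative))
      \<le> prb s f * cost \<pi> ((s, f) # h, next_state s f (\<pi> ((s, f) # h)))" for f
  proof (cases "prb s f = 0")
    case False
    let ?a = "\<pi> ((s, f) # h)"
    have "W n (next_state s f ?a) \<le> cost \<pi> ((s, f) # h, next_state s f ?a)"
      using next_in[OF Suc.prems(1) s False] Suc.prems(2) by (intro Suc.IH) simp_all
    then have "min (W n (next_state s f Independent)) (W n (next_state s f Collaborative))
      \<le> cost \<pi> ((s, f) # h, next_state s f ?a)" by (cases ?a) auto
    then show ?thesis using prb_nonneg[OF kl, of i f] by (intro mult_left_mono) (auto simp: ikl)
  qed simp
  from this[of Station1] this[of Station2] show ?case
    unfolding cost_step[OF Suc.prems(1) s] W.simps by linarith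
qed

private lemma cost_greedy: "s \<in> state_space C1 \<Longrightarrow> jobs s = n \<Longrightarrow> cost greedy (h, s) = W n s"
proof (induction n arbitrary: h s)
  case 0
  then show ?case using cost_empty by (simp add: jobs_0)
next
  case (Suc n)
  then have s: "s \<noteq> (0, 0, 0)" by (auto simp: jobs_def)
  have "prb s f * cost greedy ((s, f) # h, next_state s f (greedy ((s, f) # h)))
      = prb s f * min (W n (next_state s f Independent)) (W n (next_state s f Collaborative))" for f
  proof (cases "prb s f = 0")
    case False
    have "cost greedy ((s, f) # h, next_state s f a) = W n (next_state s f a)" for a
      using next_in[OF Suc.prems(1) s False] Suc.prems(2) by (intro Suc.IH) simp_all
    then show ?thesis using Suc.prems(2) by (simp add: greedy_def min_def)
  qed simp
  from this[of Station1] this[of Station2] show ?case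
    unfolding cost_step[OF Suc.prems(1) s] W.simps by linarith
qed

private lemma value_fn_W:
  assumes "s \<in> state_space C1"
  shows "val s = W (jobs s) s"
  unfolding value_fn_def total_cost_def
proof (rule cInf_eq_minimum)
  show "W (jobs s) s \<in> range (\<lambda>\<pi>. cost \<pi> ([], s))"
    using cost_greedy[OF assms refl, of "[]"] by (metis rangeI)
qed (use cost_lower[OF assms refl] in auto)

lemma value_fn_attained:
  "\<exists>\<pi>. \<forall>s \<in> state_space C1. val s = total_cost C2 mu1 mu2 h0 h1 h2 \<pi> s"
  using value_fn_W cost_greedy by (metis total_cost_def)

lemma value_fn_empty: "val (0, 0, 0) = 0"
  using C1 by (subst value_fn_W) (auto simp: state_space_def jobs_def)

private lemma value_fn_step:
  assumes s: "s \<in> state_space C1" "s \<noteq> (0, 0, 0)"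
  shows "val s = scost s
    + prb s Station1 * min (val (next_state s Station1 Independent)) (val (next_state s Station1 Collaborative))
    + prb s Station2 * min (val (next_state s Station2 Independent)) (val (next_state s Station2 Collaborative))"
proof -
  obtain n where n: "jobs s = Suc n" using s(2) by (cases "jobs s") (auto simp: jobs_0)
  have "prb s f * min (val (next_state s f Independent)) (val (next_state s f Collaborative))
      = prb s f * min (W n (next_state s f Independent)) (W n (next_state s f Collaborative))" for f
  proof (cases "prb s f = 0")
    case False
    have "val (next_state s f a) = W n (next_state s f a)" for a
      using next_in[OF s False, of a] n value_fn_W by simp
    then show ?thesis by simp
  qed simp
  from this[of Station1] this[of Station2] show ?thesis
    unfolding value_fn_W[OF s(1)] n W.simps by linarith
qed

lemma value_fn_empty_queue:
  assumes "(0, k, l) \<in> state_space C1" "(k, l) \<noteq> (0, 0)"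
  shows "val (0, k, l) = (real k * h1 + real l * h2) / d k l
    + real k * mu1 / d k l * val (0, k - 1, l)
    + real (min l C2) * mu2 / d k l * val (0, k, l - 1)"
proof -
  have "k + l > 0" using assms(2) by auto
  then show ?thesis
    using value_fn_step[OF assms(1)] assms(2) stay_cost_eq[of k l 0] by (simp add: prb_def)
qed

lemma value_fn_queue:
  assumes "(i, k, l) \<in> state_space C1" "i \<ge> 1"
  shows "val (i, k, l) = (real i * h0 + real k * h1 + real l * h2) / d k l
    + real k * mu1 / d k l * min (val (i - 1, k, l)) (val (i - 1, k - 1, l + 1))
    + real (min l C2) * mu2 / d k l * min (val (i - 1, k + 1, l - 1)) (val (i - 1, k, l))"
proof -
  have "k + l > 0" using space_pos[OF assms(1)] assms(2) by simp
  moreover obtain j where "i = Suc j" using assms(2) by (cases i) auto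
  ultimately show ?thesis
    using value_fn_step[OF assms(1)] stay_cost_eq[of k l i] by (simp add: prb_def)
qed

end

end

theory Submission
  imports Defs
begin

text \<open>
  While jobs are queued, all \<open>C1\<close> Type-I servers are busy, so with \<open>i\<close> queued jobs the state is
  determined by the number \<open>l\<close> of Station 2 jobs; let \<open>v i l\<close> be its value. Whichever station
  finishes first, the decision compares two neighbours \<open>v (i - 1) m\<close> and \<open>v (i - 1) (m + 1)\<close>, and
  collaborative service is optimal iff \<open>v (i - 1) (m + 1) \<le> v (i - 1) m\<close>. Both claims therefore say
  that the slope \<open>v j (m + 1) - v j m\<close>, once positive, stays positive as \<open>m\<close> grows. The proof
  establishes more: every \<open>v j\<close> is convex in \<open>l\<close> (lemma \<open>value_convex\<close>), by induction on \<open>j\<close>.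

  For \<open>j = 0\<close> the stations no longer interact, the value is explicit, and the last of \<open>l\<close>
  Station 2 jobs costs more the longer it waits behind the \<open>C2\<close> servers.

  For the induction step write \<open>M l = min (v i l) (v i (l + 1))\<close>, the value once a freed server has
  decided, and \<open>A l = M (l + 1) - M l\<close>. If \<open>v i\<close> is convex then \<open>A l\<close> lies between the slopes of
  \<open>v i\<close> at \<open>l\<close> and at \<open>l + 1\<close>, so \<open>A\<close> is nondecreasing as well. The rates of the optimality
  equation depend on \<open>l\<close>, so convexity of \<open>M\<close> does not pass to \<open>v (i + 1)\<close> by itself. Subtracting
  three neighbouring equations shows what is missing (lemma \<open>convex_step\<close>): the slope of \<open>v (i + 1)\<close>
  at \<open>l\<close> must be at most \<open>A l\<close> where replacing a Station 1 job by a Station 2 job speeds the system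
  up, and at least \<open>A (l - 1)\<close> where it slows the system down.

  These comparisons come from one identity (lemma \<open>slope_recursion\<close>): the slope of \<open>v (i + 1)\<close> at
  \<open>l\<close> is a weighted average of \<open>A l\<close>, \<open>A (l - 1)\<close> and an explicit number \<open>target (i + 1) l\<close>. The
  target does not depend on \<open>l\<close> within \<open>l < C2\<close> and within \<open>l \<ge> C2\<close>.
  If Station 2 is the faster one, the target is a lower bound of the slopes below \<open>C2\<close> and an upper
  bound from \<open>C2\<close> on; both bounds reproduce themselves under averaging, and they put the average
  on the required side of \<open>A l\<close> or \<open>A (l - 1)\<close>. If Station 2 is the slower one, the target is
  nondecreasing in \<open>i\<close>, hence so are the slopes, and \<open>A (l - 1)\<close> is at most the slope of \<open>v i\<close> at \<open>l\<close>, thus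
  at most that of \<open>v (i + 1)\<close>.
\<close>

section \<open>The optimality equations with all Type-I servers busy\<close>

text \<open>
  Here \<open>N\<close>, \<open>C\<close>, \<open>a\<close>, \<open>b\<close> stand for \<open>C1\<close>, \<open>C2\<close>, \<open>mu1\<close>, \<open>mu2\<close>, and \<open>v i l\<close> for the value of
  \<open>(i, N - l, l)\<close>. With an empty queue, moving one job from Station 1 to Station 2 costs the expected
  sojourn of the job now last at Station 2, at rate \<open>h2\<close>, and saves \<open>h1 / a\<close>.
\<close>

locale server_line =
  fixes N C :: nat and a b h0 h1 h2 :: real and v :: "nat \<Rightarrow> nat \<Rightarrow> real"
  assumes C_pos: "1 \<le> C" and C_less: "C < N"
    and a_pos: "0 < a" and b_pos: "0 < b"
    and h0_pos: "0 < h0" and h2_pos: "0 < h2"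
    and v_empty_queue: "\<And>l. l < N \<Longrightarrow>
      v 0 (Suc l) = v 0 l + h2 / b * (1 + real (Suc l - C) / real C) - h1 / a"
    and v_queue: "\<And>i l. l \<le> N \<Longrightarrow>
      (real (N - l) * a + real (min l C) * b) * v (Suc i) l
      = real (Suc i) * h0 + real (N - l) * h1 + real l * h2
        + real (N - l) * a * min (v i l) (v i (Suc l))
        + real (min l C) * b * min (v i (l - 1)) (v i l)"
begin

definition rate :: "nat \<Rightarrow> real" where
  "rate l = real (N - l) * a + real (min l C) * b"

definition slope :: "nat \<Rightarrow> nat \<Rightarrow> real" where
  "slope i l = v i (Suc l) - v i l"

text \<open>
  The value when a server has just become free next to \<open>l\<close> jobs at Station 2 and \<open>N - l - 1\<close> at
  Station 1, and \<open>i\<close> jobs will remain in the queue after its decision.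
\<close>

definition best :: "nat \<Rightarrow> nat \<Rightarrow> real" where
  "best i l = min (v i l) (v i (Suc l))"

definition best_slope :: "nat \<Rightarrow> nat \<Rightarrow> real" where
  "best_slope i l = best i (Suc l) - best i l"

definition convex_value :: "nat \<Rightarrow> bool" where
  "convex_value i \<longleftrightarrow> (\<forall>l. Suc l < N \<longrightarrow> slope i l \<le> slope i (Suc l))"

text \<open>Extra holding cost of serving one job, without waiting, at Station 2 rather than Station 1.\<close>

definition cost_gap :: real where
  "cost_gap = h2 / b - h1 / a"

text \<open>For nondecreasing slopes this is the median of \<open>0\<close> and two neighbouring slopes.\<close>

lemma best_slope_eq: "best_slope i l = max 0 (slope i l) + min 0 (slope i (Suc l))"
  by (auto simp: best_slope_def best_def slope_def)

lemma best_slope_bounds: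
  assumes "convex_value i" "Suc l < N"
  shows "slope i l \<le> best_slope i l" "best_slope i l \<le> slope i (Suc l)"
proof -
  have "slope i l \<le> slope i (Suc l)" using assms by (auto simp: convex_value_def)
  then show "slope i l \<le> best_slope i l" "best_slope i l \<le> slope i (Suc l)"
    by (auto simp: best_slope_eq)
qed

lemma best_slope_mono:
  assumes "convex_value i" "Suc (Suc l) < N"
  shows "best_slope i l \<le> best_slope i (Suc l)"
  using best_slope_bounds(2)[of i l] best_slope_bounds(1)[of i "Suc l"] assms by simp

lemma rate_pos: "l \<le> N \<Longrightarrow> 0 < rate l"
proof (cases "l = N")
  case True
  then have "0 < real (min l C) * b" using b_pos C_pos C_less by simp
  then show ?thesis using True by (simp add: rate_def)
next
  case False
  assume "l \<le> N"
  with False have "0 < real (N - l) * a" using a_pos by simp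
  moreover have "0 \<le> real (min l C) * b" using b_pos by simp
  ultimately show ?thesis unfolding rate_def by linarith
qed

lemma rate_queue:
  assumes "l \<le> N"
  shows "rate l * v (Suc i) l = real (Suc i) * h0 + real (N - l) * h1 + real l * h2
    + real (N - l) * a * best i l + real (min l C) * b * best i (l - 1)"
  using v_queue[OF assms, of i] by (cases l) (simp_all add: rate_def best_def)

section \<open>The slope recursion\<close>

text \<open>
  \<open>target i l\<close> is the number that \<open>slope_recursion\<close> forces: it gathers the contribution of the holding
  costs to the slope with \<open>i\<close> queued jobs, divided by \<open>pull\<close>, the weight that is left for it. The
  term proportional to \<open>i\<close> is the queue's cost of the change of the total rate when \<open>l\<close> grows by one.
\<close>

definition pull :: "nat \<Rightarrow> real" where
  "pull l = (if l < C then N * a * b else C * a * b)"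

definition target :: "nat \<Rightarrow> nat \<Rightarrow> real" where
  "target i l = (if l < C then cost_gap + real i * ((a - b) * h0 / (N * a * b))
     else (h2 - h1) / a + N * h2 / (C * b) + real i * (h0 / (C * b)))"

lemma target_Suc:
  "target (Suc i) l = target i l + (if l < C then (a - b) * h0 / (N * a * b) else h0 / (C * b))"
  by (simp add: target_def distrib_right add_divide_distrib)

lemma pull_pos: "0 < pull l"
  using C_pos C_less a_pos b_pos by (simp add: pull_def)

text \<open>
  The optimality equations at \<open>l\<close> and \<open>Suc l\<close> share the term \<open>best i l\<close>: a Station 1 completion at \<open>l\<close>
  and a Station 2 completion at \<open>Suc l\<close> leave the same state behind. After multiplying by both
  rates it cancels, and only differences of \<open>best i\<close> remain.
\<close>

lemma slope_recursion:
  assumes l: "l < N"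
  shows "rate l * rate (Suc l) * slope (Suc i) l
    = pull l * target (Suc i) l + (real (N - l) - 1) * a * rate l * best_slope i l
      + real (min l C) * b * rate (Suc l) * best_slope i (l - 1)"
proof -
  define n x t where "n = real N" and "x = real l" and "t = real (Suc i) * h0"
  have k: "real (N - l) = n - x" "real (N - Suc l) = n - x - 1"
    using l by (simp_all add: n_def x_def)
  have c: "real C > 0" using C_pos by simp
  have n0: "0 < n" using C_less by (simp add: n_def)
  have E1: "rate l * v (Suc i) l = t + (n - x) * h1 + x * h2
    + (n - x) * a * best i l + real (min l C) * b * best i (l - 1)"
    using rate_queue[of l i] l k unfolding t_def x_def by simp
  have E2: "rate (Suc l) * v (Suc i) (Suc l) = t + (n - x - 1) * h1 + (x + 1) * h2
    + (n - x - 1) * a * best i (Suc l) + real (min (Suc l) C) * b * best i l"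
    using rate_queue[of "Suc l" i] l k unfolding t_def x_def by (simp add: algebra_simps)
  \<comment> \<open>The factor \<open>min l C\<close> vanishes at \<open>l = 0\<close>, where \<open>l - 1\<close> is truncated.\<close>
  have prev: "real (min l C) * best i (l - 1) = real (min l C) * (best i l - best_slope i (l - 1))"
    by (cases l) (simp_all add: best_slope_def)
  have nxt: "best i (Suc l) = best i l + best_slope i l" by (simp add: best_slope_def)
  have r: "rate l = (n - x) * a + real (min l C) * b"
    "rate (Suc l) = (n - x - 1) * a + real (min (Suc l) C) * b"
    unfolding rate_def k by simp_all
  have "rate l * rate (Suc l) * slope (Suc i) l
     = rate l * (rate (Suc l) * v (Suc i) (Suc l)) - rate (Suc l) * (rate l * v (Suc i) l)"
    by (simp add: slope_def algebra_simps)
  also have "\<dots> = rate l * (t + (n - x - 1) * h1 + (x + 1) * h2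
       + (n - x - 1) * a * (best i l + best_slope i l) + real (min (Suc l) C) * b * best i l)
     - rate (Suc l) * (t + (n - x) * h1 + x * h2
       + (n - x) * a * best i l + b * (real (min l C) * (best i l - best_slope i (l - 1))))"
    unfolding E1 E2 nxt prev[symmetric] by (simp add: algebra_simps)
  also have "\<dots> = (rate l * (t + (n - x - 1) * h1 + (x + 1) * h2)
        - rate (Suc l) * (t + (n - x) * h1 + x * h2))
      + (n - x - 1) * a * rate l * best_slope i l
      + real (min l C) * b * rate (Suc l) * best_slope i (l - 1)"
    unfolding r by (simp add: algebra_simps)
  also have "rate l * (t + (n - x - 1) * h1 + (x + 1) * h2)
        - rate (Suc l) * (t + (n - x) * h1 + x * h2) = pull l * target (Suc i) l"
  proof (cases "l < C")
    case True
    then have mins: "real (min l C) = x" "real (min (Suc l) C) = x + 1"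
      by (simp_all add: x_def)
    have "pull l * target (Suc i) l = n * (a * h2 - b * h1) + t * (a - b)"
      using True a_pos b_pos n0
      unfolding pull_def target_def cost_gap_def t_def n_def[symmetric]
      by (simp add: field_simps)
    then show ?thesis unfolding r mins by (simp add: algebra_simps)
  next
    case False
    then have mins: "real (min l C) = C" "real (min (Suc l) C) = C" by simp_all
    have "pull l * target (Suc i) l = C * b * (h2 - h1) + n * a * h2 + t * a"
      using False a_pos b_pos c unfolding pull_def target_def t_def n_def[symmetric]
      by (simp add: field_simps)
    then show ?thesis unfolding r mins by (simp add: algebra_simps)
  qed
  finally show ?thesis unfolding k .
qed

text \<open>The three weights of \<open>slope_recursion\<close> add up: the new slope is a weighted average.\<close>

lemma weights_sum:
  assumes "l < N"
  shows "pull l + (real (N - l) - 1) * a * rate l + real (min l C) * b * rate (Suc l)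
    = rate l * rate (Suc l)"
proof -
  define n x where "n = real N" and "x = real l"
  have k: "real (N - l) = n - x" "real (N - Suc l) = n - x - 1"
    using assms by (simp_all add: n_def x_def)
  have r: "rate l = (n - x) * a + real (min l C) * b"
    "rate (Suc l) = (n - x - 1) * a + real (min (Suc l) C) * b"
    unfolding rate_def k by simp_all
  show ?thesis
  proof (cases "l < C")
    case True
    then have mins: "real (min l C) = x" "real (min (Suc l) C) = x + 1"
      by (simp_all add: x_def)
    show ?thesis
      using True unfolding pull_def r mins k n_def[symmetric] by (simp add: algebra_simps)
  next
    case False
    then have mins: "real (min l C) = C" "real (min (Suc l) C) = C" by simp_all
    show ?thesis using False unfolding pull_def r mins k by (simp add: algebra_simps)
  qed
qed

lemma weights_sum_mult:
  assumes "l < N"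
  shows "rate l * rate (Suc l) * x = pull l * x + (real (N - l) - 1) * a * rate l * x
    + real (min l C) * b * rate (Suc l) * x"
  unfolding weights_sum[OF assms, symmetric] by (simp only: distrib_right)

text \<open>
  The hypotheses are guarded because the first weight is \<open>0\<close> at \<open>l = N - 1\<close> and the second at
  \<open>l = 0\<close>, where the neighbouring differences leave the range \<open>0..N\<close>.
\<close>

lemma weighted_part_mono:
  assumes l: "l < N"
    and up: "Suc l < N \<Longrightarrow> p \<le> p'" and down: "1 \<le> l \<Longrightarrow> q \<le> q'"
  shows "(real (N - l) - 1) * a * rate l * p + real (min l C) * b * rate (Suc l) * q
    \<le> (real (N - l) - 1) * a * rate l * p' + real (min l C) * b * rate (Suc l) * q'"
proof (rule add_mono)
  have r: "0 \<le> rate l" "0 \<le> rate (Suc l)" using rate_pos[of l] rate_pos[of "Suc l"] l by simp_all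
  show "(real (N - l) - 1) * a * rate l * p \<le> (real (N - l) - 1) * a * rate l * p'"
  proof (cases "Suc l < N")
    case True
    then show ?thesis using r up a_pos by (intro mult_left_mono mult_nonneg_nonneg) auto
  next
    case False
    then have "real (N - l) - 1 = 0" using l by (simp add: of_nat_diff)
    then show ?thesis by simp
  qed
  show "real (min l C) * b * rate (Suc l) * q \<le> real (min l C) * b * rate (Suc l) * q'"
  proof (cases "1 \<le> l")
    case True
    then show ?thesis using r down b_pos by (intro mult_left_mono mult_nonneg_nonneg) auto
  next
    case False
    then have "l = 0" by simp
    then show ?thesis by simp
  qed
qed

lemma slope_Suc_le:
  assumes l: "l < N" and tg: "target (Suc i) l \<le> x"
    and "Suc l < N \<Longrightarrow> best_slope i l \<le> x" and "1 \<le> l \<Longrightarrow> best_slope i (l - 1) \<le> x"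
  shows "slope (Suc i) l \<le> x"
proof -
  have "rate l * rate (Suc l) * slope (Suc i) l \<le> rate l * rate (Suc l) * x"
    using weighted_part_mono[OF l assms(3,4)] mult_left_mono[OF tg less_imp_le[OF pull_pos[of l]]]
      slope_recursion[OF l, of i] weights_sum_mult[OF l, of x] by linarith
  then show ?thesis using rate_pos[of l] rate_pos[of "Suc l"] l by simp
qed

lemma slope_Suc_ge:
  assumes l: "l < N" and tg: "x \<le> target (Suc i) l"
    and "Suc l < N \<Longrightarrow> x \<le> best_slope i l" and "1 \<le> l \<Longrightarrow> x \<le> best_slope i (l - 1)"
  shows "x \<le> slope (Suc i) l"
proof -
  have "rate l * rate (Suc l) * x \<le> rate l * rate (Suc l) * slope (Suc i) l"
    using weighted_part_mono[OF l assms(3,4)] mult_left_mono[OF tg less_imp_le[OF pull_pos[of l]]]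
      slope_recursion[OF l, of i] weights_sum_mult[OF l, of x] by linarith
  then show ?thesis using rate_pos[of l] rate_pos[of "Suc l"] l by simp
qed

section \<open>Propagation of convexity\<close>

text \<open>
  Combining the optimality equations at \<open>m\<close>, \<open>m + 1\<close>, \<open>m + 2\<close> leaves a positive multiple of the second
  difference of \<open>v (Suc i)\<close> on one side. On the other side are second differences of \<open>best i\<close>,
  nonnegative by convexity of \<open>v i\<close>, and a remainder for the two servers whose stations differ
  among the three states. It compares \<open>best_slope i m\<close> with the slope of \<open>v (Suc i)\<close> at \<open>m\<close> or at
  \<open>m + 1\<close>, times the change of the total rate. At \<open>m + 1 = C\<close> the sign of this change may switch; moreover
  the last Station 2 job of the state \<open>m + 2\<close> waits without being served, so that
  \<open>b * (v (Suc i) C - best i (C - 1))\<close> is left over, which is nonnegative by \<open>capacity\<close>.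
\<close>

lemma convex_step:
  assumes cv: "convex_value i"
    and mid: "(a \<le> b \<and> (\<forall>l<C. slope (Suc i) l \<le> best_slope i l))
      \<or> (b \<le> a \<and> (\<forall>l. Suc l < C \<longrightarrow> best_slope i l \<le> slope (Suc i) (Suc l)))"
    and high: "\<And>l. C \<le> Suc l \<Longrightarrow> Suc l < N \<Longrightarrow> best_slope i l \<le> slope (Suc i) (Suc l)"
    and capacity: "best i (C - 1) \<le> v (Suc i) C"
  shows "convex_value (Suc i)"
  unfolding convex_value_def
proof (intro allI impI)
  fix m assume m: "Suc m < N"
  \<comment> \<open>\<open>w\<close> Station 1 servers are busy in all three states \<open>m\<close>, \<open>m + 1\<close>, \<open>m + 2\<close>.\<close>
  define w x c t where "w = real (N - Suc m) - 1" and "x = real m" and "c = real C"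
    and "t = real (Suc i) * h0"
  define G where "G = best_slope i"
  define Z where "Z = slope (Suc i) (Suc m) - slope (Suc i) m"
  have k: "real (N - m) = w + 2" "real (N - Suc m) = w + 1" "real (N - Suc (Suc m)) = w"
    using m by (simp_all add: w_def of_nat_diff)
  have w0: "0 \<le> w" using m by (simp add: w_def)
  have up: "0 \<le> w * (G (Suc m) - G m)"
  proof (cases "Suc (Suc m) < N")
    case True
    then show ?thesis using best_slope_mono[OF cv, of m] w0 by (simp add: G_def)
  next
    case False
    then have "w = 0" using m by (simp add: w_def)
    then show ?thesis by simp
  qed
  have down: "0 \<le> x * (G m - G (m - 1))"
    using best_slope_mono[OF cv, of "m - 1"] m by (cases m) (simp_all add: x_def G_def)
  have up': "0 \<le> a * (w * (G (Suc m) - G m))" and down': "0 \<le> b * (x * (G m - G (m - 1)))"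
    using up down a_pos b_pos by simp_all
  define M0 M1 M2 where "M0 = best i m" and "M1 = best i (Suc m)" and "M2 = best i (Suc (Suc m))"
  have Gm: "G m = M1 - M0" "G (Suc m) = M2 - M1"
    by (simp_all add: G_def best_slope_def M0_def M1_def M2_def)
  define Mp where "Mp = best i (m - 1)"
  define g where "g = G (m - 1)"
  have xG: "x * g = x * (M0 - Mp)"
    by (cases m) (simp_all add: g_def x_def G_def best_slope_def M0_def Mp_def)
  define V0 V1 V2 where "V0 = v (Suc i) m" and "V1 = v (Suc i) (Suc m)"
    and "V2 = v (Suc i) (Suc (Suc m))"
  have sl: "slope (Suc i) m = V1 - V0" "slope (Suc i) (Suc m) = V2 - V1"
    by (simp_all add: slope_def V0_def V1_def V2_def)
  have Zv: "Z = V2 - 2 * V1 + V0" by (simp add: Z_def sl)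
  have R0: "((w + 2) * a + real (min m C) * b) * V0 = t + (w + 2) * h1 + x * h2
      + (w + 2) * a * M0 + real (min m C) * b * Mp"
    using rate_queue[of m i] m
    unfolding rate_def k V0_def M0_def Mp_def x_def t_def by simp
  have R1: "((w + 1) * a + real (min (Suc m) C) * b) * V1 = t + (w + 1) * h1 + (x + 1) * h2
      + (w + 1) * a * M1 + real (min (Suc m) C) * b * M0"
    using rate_queue[of "Suc m" i] m
    unfolding rate_def k V1_def M1_def M0_def x_def t_def by (simp add: algebra_simps)
  have R2: "(w * a + real (min (Suc (Suc m)) C) * b) * V2 = t + w * h1 + (x + 2) * h2
      + w * a * M2 + real (min (Suc (Suc m)) C) * b * M1"
    using rate_queue[of "Suc (Suc m)" i] m
    unfolding rate_def k V2_def M2_def M1_def x_def t_def by (simp add: algebra_simps)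
  have x0: "0 \<le> x" by (simp add: x_def)
  consider "Suc m < C" | "Suc m = C" | "C < Suc m" by linarith
  then have "0 \<le> Z"
  proof cases
    case 1
    then have mins: "real (min m C) = x" "real (min (Suc m) C) = x + 1"
      "real (min (Suc (Suc m)) C) = x + 2" by (simp_all add: x_def)
    \<comment> \<open>Each of the slopes \<open>V1 - V0\<close> and \<open>V2 - V1\<close> can be split off from the left side; the sign of
      \<open>b - a\<close> decides which one leaves a comparison with \<open>G m\<close> of the right sign.\<close>
    have id: "(w * a + x * b) * Z + b * V2 * 2 - 2 * (a + b) * V1 + 2 * a * V0
        = a * (w * (G (Suc m) - G m)) + b * (x * (G m - g)) + 2 * (b - a) * G m"
      using R0 R1 R2 xG unfolding mins Zv Gm by algebra
    from mid show ?thesis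
    proof
      assume h: "a \<le> b \<and> (\<forall>l<C. slope (Suc i) l \<le> best_slope i l)"
      then have "slope (Suc i) m \<le> G m" using 1 by (simp add: G_def)
      then have "0 \<le> (b - a) * (G m - (V1 - V0))" using h sl by simp
      then have "0 \<le> (w * a + x * b + 2 * b) * Z"
        using id up' down'[folded g_def] unfolding Zv by (simp add: algebra_simps)
      moreover have "0 < w * a + x * b + 2 * b" using w0 x0 a_pos b_pos
        by (intro add_nonneg_pos add_nonneg_nonneg) auto
      ultimately show ?thesis by (simp add: zero_le_mult_iff)
    next
      assume h: "b \<le> a \<and> (\<forall>l. Suc l < C \<longrightarrow> best_slope i l \<le> slope (Suc i) (Suc l))"
      then have "G m \<le> slope (Suc i) (Suc m)" using 1 by (simp add: G_def)
      then have "0 \<le> (a - b) * ((V2 - V1) - G m)" using h sl by simp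
      then have "0 \<le> (w * a + x * b + 2 * a) * Z"
        using id up' down'[folded g_def] unfolding Zv by (simp add: algebra_simps)
      moreover have "0 < w * a + x * b + 2 * a" using w0 x0 a_pos b_pos
        by (intro add_nonneg_pos add_nonneg_nonneg) auto
      ultimately show ?thesis by (simp add: zero_le_mult_iff)
    qed
  next
    case 2
    then have mins: "real (min m C) = x" "real (min (Suc m) C) = x + 1"
      "real (min (Suc (Suc m)) C) = x + 1" by (auto simp: x_def)
    have id: "(w * a + x * b) * Z + b * V2 - 2 * (a + b) * V1 + 2 * a * V0
        = a * (w * (G (Suc m) - G m)) + b * (x * (G m - g)) - 2 * a * G m
          + b * (M1 - 2 * M0)"
      using R0 R1 R2 xG unfolding mins Zv Gm by algebra
    have bd: "0 \<le> b * (V1 - M0)"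
      using capacity 2 b_pos by (auto simp: V1_def M0_def)
    have hi: "0 \<le> (V2 - V1) - G m" using high[of m] 2 m sl by (simp add: G_def)
    from mid show ?thesis
    proof
      assume h: "a \<le> b \<and> (\<forall>l<C. slope (Suc i) l \<le> best_slope i l)"
      then have "slope (Suc i) m \<le> G m" using 2 by (simp add: G_def)
      then have "0 \<le> b * (G m - (V1 - V0))" using sl b_pos by simp
      moreover have "0 \<le> a * ((V2 - V1) - G m)" using hi a_pos by simp
      ultimately have "0 \<le> (w * a + x * b + 2 * a + b) * Z"
        using id up' down'[folded g_def] bd unfolding Zv Gm by (simp add: algebra_simps)
      moreover have "0 < w * a + x * b + 2 * a + b" using w0 x0 a_pos b_pos
        by (intro add_nonneg_pos add_nonneg_nonneg) auto
      ultimately show ?thesis by (simp add: zero_le_mult_iff)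
    next
      assume h: "b \<le> a \<and> (\<forall>l. Suc l < C \<longrightarrow> best_slope i l \<le> slope (Suc i) (Suc l))"
      then have "0 \<le> (2 * a - b) * ((V2 - V1) - G m)" using hi a_pos by simp
      then have "0 \<le> (w * a + x * b + 2 * a) * Z"
        using id up' down'[folded g_def] bd unfolding Zv Gm by (simp add: algebra_simps)
      moreover have "0 < w * a + x * b + 2 * a" using w0 x0 a_pos b_pos
        by (intro add_nonneg_pos add_nonneg_nonneg) auto
      ultimately show ?thesis by (simp add: zero_le_mult_iff)
    qed
  next
    case 3
    then have mins: "real (min m C) = c" "real (min (Suc m) C) = c"
      "real (min (Suc (Suc m)) C) = c" by (auto simp: c_def)
    have m1: "1 \<le> m" using 3 C_pos by simp
    then have Gp: "G (m - 1) = M0 - Mp" by (simp add: G_def best_slope_def M0_def Mp_def)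
    have c0: "0 < c" using C_pos by (simp add: c_def)
    have "G (m - 1) \<le> G m" using best_slope_mono[OF cv, of "m - 1"] m m1 by (simp add: G_def)
    then have dn: "0 \<le> b * (c * (G m - G (m - 1)))" using b_pos c0 by simp
    have id: "(w * a + c * b) * Z - 2 * a * V1 + 2 * a * V0
        = a * (w * (G (Suc m) - G m)) + b * (c * (G m - G (m - 1))) - 2 * a * G m"
      using R0 R1 R2 unfolding mins Zv Gm Gp by algebra
    have "0 \<le> a * ((V2 - V1) - G m)" using high[of m] 3 m sl a_pos by (simp add: G_def)
    then have "0 \<le> (w * a + c * b + 2 * a) * Z"
      using id up' dn unfolding Zv by (simp add: algebra_simps)
    moreover have "0 < w * a + c * b + 2 * a" using w0 c0 a_pos b_pos
      by (intro add_nonneg_pos add_nonneg_nonneg) auto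
    ultimately show ?thesis by (simp add: zero_le_mult_iff)
  qed
  then show "slope (Suc i) m \<le> slope (Suc i) (Suc m)" by (simp add: Z_def)
qed

text \<open>
  By the optimality equation the difference of the two sides is a multiple of the holding cost rate plus
  \<open>(N - C) * a * best_slope i (C - 1)\<close>. The given lower bound on the slope is just what the holding
  costs outweigh: \<open>- h1 / a\<close> is paid by the Station 1 jobs and \<open>- h0 / (N * a)\<close> per queued job by
  the queue.
\<close>

lemma best_le_value_at_capacity:
  assumes cv: "convex_value i" and low: "cost_gap - real i * (h0 / (N * a)) \<le> slope i (C - 1)"
  shows "best i (C - 1) \<le> v (Suc i) C"
proof -
  define k where "k = real (N - C)"
  have k: "0 \<le> k" "k \<le> N" and n0: "0 < real N" using C_less by (simp_all add: k_def)
  have "cost_gap - real i * (h0 / (N * a)) \<le> best_slope i (C - 1)"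
    using best_slope_bounds(1)[OF cv, of "C - 1"] low C_pos C_less by simp
  then have "k * a * (cost_gap - real i * (h0 / (N * a))) \<le> k * a * best_slope i (C - 1)"
    using k a_pos by (intro mult_left_mono) auto
  moreover have "k * a * (cost_gap - real i * (h0 / (N * a)))
      = k * a * h2 / b - k * h1 - real i * h0 * (k / N)"
    using a_pos b_pos n0 by (simp add: cost_gap_def field_simps)
  moreover have "real i * h0 * (k / N) \<le> real i * h0 * 1"
    using k n0 h0_pos by (intro mult_left_mono) auto
  moreover have "0 \<le> k * a * h2 / b" using k a_pos b_pos h2_pos by simp
  moreover have "0 \<le> real C * h2" using h2_pos by simp
  ultimately have "0 \<le> real (Suc i) * h0 + k * h1 + C * h2 + k * a * best_slope i (C - 1)"
    using h0_pos by (simp add: algebra_simps)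
  also have "\<dots> = rate C * (v (Suc i) C - best i (C - 1))"
    using rate_queue[of C i] C_less C_pos
    by (simp add: best_slope_def k_def rate_def algebra_simps)
  finally show ?thesis using rate_pos[of C] C_less by (simp add: zero_le_mult_iff)
qed

section \<open>Convexity for either order of the service rates\<close>

lemma slope_0:
  assumes "l < N"
  shows "slope 0 l = cost_gap + real (Suc l - C) * (h2 / (C * b))"
proof -
  have "slope 0 l = h2 / b * (1 + real (Suc l - C) / C) - h1 / a"
    using v_empty_queue[OF assms] by (simp add: slope_def)
  then show ?thesis using b_pos by (simp add: cost_gap_def distrib_left mult_ac)
qed

lemma convex_0: "convex_value 0"
  unfolding convex_value_def
proof (intro allI impI)
  fix l assume l: "Suc l < N"
  have "real (Suc l - C) * (h2 / (C * b)) \<le> real (Suc (Suc l) - C) * (h2 / (C * b))"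
    using b_pos h2_pos by (intro mult_right_mono) auto
  then show "slope 0 l \<le> slope 0 (Suc l)" using slope_0[of l] slope_0[of "Suc l"] l by simp
qed

text \<open>
  With an empty queue, a server left idle may be regarded as taking an independent job whose cost is
  not counted. A Station 1 completion then keeps \<open>l\<close> and a Station 2 completion lowers it, so
  \<open>slope 0\<close> obeys the slope recursion with itself in place of \<open>best_slope\<close> and without a cost of
  queueing. In this form it can be compared with \<open>slope 1\<close>.
\<close>

lemma slope_0_recursion:
  assumes l: "l < N"
  shows "rate l * rate (Suc l) * slope 0 l
    = pull l * target 0 l + (real (N - l) - 1) * a * rate l * slope 0 l
      + real (min l C) * b * rate (Suc l) * slope 0 (l - 1)"
proof (cases "l < C")
  case True
  then have "slope 0 l = cost_gap" "slope 0 (l - 1) = cost_gap" "target 0 l = cost_gap"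
    using l by (simp_all add: slope_0 target_def)
  then show ?thesis using weights_sum_mult[OF l, of cost_gap] by simp
next
  case False
  define e where "e = h2 / (C * b)"
  have c0: "0 < real C" using C_pos by simp
  have s: "slope 0 l = cost_gap + (real l + 1 - C) * e" "slope 0 (l - 1) = slope 0 l - e"
  proof -
    have "real (Suc l - C) = real l + 1 - C" "real (Suc (l - 1) - C) = real l - C"
      using False C_pos by (simp_all add: of_nat_diff)
    then show "slope 0 l = cost_gap + (real l + 1 - C) * e"
      and "slope 0 (l - 1) = slope 0 l - e"
      using slope_0[of l, folded e_def] slope_0[of "l - 1", folded e_def] l less_imp_diff_less[OF l]
      by (simp_all add: algebra_simps)
  qed
  have "pull l * (target 0 l - slope 0 l) = C * b * rate (Suc l) * e"
    using l False a_pos b_pos c0 unfolding s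
    by (simp add: pull_def target_def cost_gap_def rate_def e_def of_nat_diff field_simps)
  moreover have "real (min l C) * b * rate (Suc l) * slope 0 (l - 1)
      = real (min l C) * b * rate (Suc l) * slope 0 l - C * b * rate (Suc l) * e"
    using False unfolding s(2) by (simp add: right_diff_distrib)
  ultimately show ?thesis using weights_sum_mult[OF l, of "slope 0 l"]
    by (simp add: right_diff_distrib)
qed

lemma best_slope_le_best_slope:
  assumes "slope i l \<le> slope j l" "slope i (Suc l) \<le> slope j (Suc l)"
  shows "best_slope i l \<le> best_slope j l"
  using assms by (auto simp: best_slope_eq)

text \<open>
  Moving a job to Station 2 never speeds the system up, so each further queued job does not lower
  the slopes: targets are nondecreasing in \<open>i\<close>, and weighted averaging preserves the order. Hence
  \<open>best_slope i l \<le> slope i (Suc l) \<le> slope (Suc i) (Suc l)\<close>, which is what \<open>convex_step\<close> asks for.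
\<close>

lemma convex_if_Station2_slower:
  assumes ba: "b \<le> a"
  shows "convex_value i \<and> (\<forall>l<N. cost_gap \<le> slope i l) \<and> (\<forall>l<N. slope i l \<le> slope (Suc i) l)"
proof (induction i)
  case 0
  have "slope 0 l \<le> slope (Suc 0) l" if l: "l < N" for l
  proof -
    have tg: "target 0 l \<le> target (Suc 0) l"
      using ba a_pos b_pos h0_pos by (simp add: target_Suc)
    have "(real (N - l) - 1) * a * rate l * slope 0 l
          + real (min l C) * b * rate (Suc l) * slope 0 (l - 1)
        \<le> (real (N - l) - 1) * a * rate l * best_slope 0 l
          + real (min l C) * b * rate (Suc l) * best_slope 0 (l - 1)"
      using l by (intro weighted_part_mono best_slope_bounds convex_0) auto
    then have "rate l * rate (Suc l) * slope 0 l \<le> rate l * rate (Suc l) * slope (Suc 0) l"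
      using mult_left_mono[OF tg less_imp_le[OF pull_pos[of l]]]
      unfolding slope_recursion[OF l] slope_0_recursion[OF l] by linarith
    then show ?thesis using rate_pos[of l] rate_pos[of "Suc l"] l by simp
  qed
  moreover have "cost_gap \<le> slope 0 l" if "l < N" for l
    using that b_pos h2_pos by (simp add: slope_0)
  ultimately show ?case using convex_0 by blast
next
  case (Suc i)
  then have cv: "convex_value i" and pen: "\<And>l. l < N \<Longrightarrow> cost_gap \<le> slope i l"
    and inc: "\<And>l. l < N \<Longrightarrow> slope i l \<le> slope (Suc i) l" by auto
  have step: "best_slope i l \<le> slope (Suc i) (Suc l)" if "Suc l < N" for l
    using best_slope_bounds(2)[OF cv that] inc[OF that] by simp
  have "0 \<le> real i * (h0 / (N * a))" using h0_pos a_pos by simp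
  then have "best i (C - 1) \<le> v (Suc i) C"
    using pen[of "C - 1"] C_less by (intro best_le_value_at_capacity cv) linarith
  then have "convex_value (Suc i)" using step ba C_less by (intro convex_step cv) auto
  moreover have "slope (Suc i) l \<le> slope (Suc (Suc i)) l" if l: "l < N" for l
  proof -
    have tg: "target (Suc i) l \<le> target (Suc (Suc i)) l"
      using ba a_pos b_pos h0_pos by (simp add: target_Suc)
    have "(real (N - l) - 1) * a * rate l * best_slope i l
          + real (min l C) * b * rate (Suc l) * best_slope i (l - 1)
        \<le> (real (N - l) - 1) * a * rate l * best_slope (Suc i) l
          + real (min l C) * b * rate (Suc l) * best_slope (Suc i) (l - 1)"
      using l by (intro weighted_part_mono best_slope_le_best_slope inc) auto
    then have "rate l * rate (Suc l) * slope (Suc i) l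
        \<le> rate l * rate (Suc l) * slope (Suc (Suc i)) l"
      using mult_left_mono[OF tg less_imp_le[OF pull_pos[of l]]]
      unfolding slope_recursion[OF l] by linarith
    then show ?thesis using rate_pos[of l] rate_pos[of "Suc l"] l by simp
  qed
  moreover have "cost_gap \<le> slope (Suc i) l" if "l < N" for l
    using pen[OF that] inc[OF that] by simp
  ultimately show ?case by blast
qed

text \<open>
  Slopes need not be monotone in \<open>i\<close> here. Instead they stay on one side of the target: below \<open>C\<close> the
  targets are nonincreasing in \<open>i\<close>, so a lower bound by \<open>target i\<close> is also one by \<open>target (Suc i)\<close> and
  survives averaging with it; from \<open>C\<close> on all inequalities are reversed. The largest of the three
  averaged numbers is then \<open>best_slope i l\<close> below \<open>C\<close>, and the smallest is \<open>best_slope i (l - 1)\<close>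
  from \<open>C\<close> on, which gives the comparisons of \<open>convex_step\<close>.
\<close>

lemma convex_if_Station2_faster:
  assumes ab: "a \<le> b"
  shows "convex_value i \<and> (\<forall>l<C. target i l \<le> slope i l)
    \<and> (\<forall>l. C \<le> l \<longrightarrow> l < N \<longrightarrow> slope i l \<le> target i l)"
proof (induction i)
  case 0
  have "target 0 l \<le> slope 0 l" if "l < C" for l
    using that C_less by (simp add: slope_0 target_def)
  moreover have "slope 0 l \<le> target 0 l" if "C \<le> l" "l < N" for l
  proof -
    have c0: "0 < real C" using C_pos by simp
    have "slope 0 l = cost_gap + (real l + 1 - C) * (h2 / (C * b))"
      using that by (simp add: slope_0 of_nat_diff algebra_simps)
    also have "\<dots> \<le> cost_gap + (real N - C) * (h2 / (C * b))"
      using that b_pos h2_pos by (intro add_left_mono mult_right_mono) auto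
    also have "\<dots> = N * h2 / (C * b) - h1 / a"
      using c0 b_pos a_pos by (simp add: cost_gap_def field_simps)
    also have "\<dots> \<le> target 0 l"
      using that h2_pos a_pos by (simp add: target_def diff_divide_distrib)
    finally show ?thesis .
  qed
  ultimately show ?case using convex_0 by blast
next
  case (Suc i)
  then have cv: "convex_value i" and lb: "\<And>l. l < C \<Longrightarrow> target i l \<le> slope i l"
    and ub: "\<And>l. C \<le> l \<Longrightarrow> l < N \<Longrightarrow> slope i l \<le> target i l" by auto
  have tl: "target (Suc i) l \<le> target i l" if "l < C" for l
    using that ab a_pos b_pos h0_pos
    by (auto simp: target_Suc intro!: divide_nonpos_nonneg mult_nonpos_nonneg)
  have th: "target i l \<le> target (Suc i) l" if "C \<le> l" for l
    using that b_pos h0_pos by (simp add: target_Suc)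
  have const_lo: "target j l = target j m" if "l < C" "m < C" for j l m
    using that by (simp add: target_def)
  have const_hi: "target j l = target j m" if "C \<le> l" "C \<le> m" for j l m
    using that by (simp add: target_def)
  have lo: "target (Suc i) l \<le> best_slope i m" if "l < C" "m < C" for l m
    using lb[of m] tl[of m] best_slope_bounds(1)[OF cv, of m] const_lo[of l m "Suc i"] that C_less
    by simp
  have hi: "best_slope i m \<le> target (Suc i) l" if "C \<le> l" "C \<le> Suc m" "Suc m < N" for l m
    using ub[of "Suc m"] th[of "Suc m"] best_slope_bounds(2)[OF cv, of m]
      const_hi[of l "Suc m" "Suc i"] that by simp
  have lb': "target (Suc i) l \<le> slope (Suc i) l" if "l < C" for l
    using that C_less lo by (intro slope_Suc_ge) auto
  have ub': "slope (Suc i) l \<le> target (Suc i) l" if "C \<le> l" "l < N" for l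
    using that hi by (intro slope_Suc_le) auto
  have mid: "slope (Suc i) l \<le> best_slope i l" if "l < C" for l
    using that C_less lo[of l l] best_slope_mono[OF cv, of "l - 1"]
    by (intro slope_Suc_le) auto
  have high: "best_slope i l \<le> slope (Suc i) (Suc l)" if "C \<le> Suc l" "Suc l < N" for l
    using that hi[of "Suc l" l] best_slope_mono[OF cv, of l]
    by (intro slope_Suc_ge) auto
  have "cost_gap - real i * (h0 / (N * a)) \<le> target i (C - 1)"
  proof -
    have "- (h0 / (N * a)) \<le> (a - b) * h0 / (N * a * b)"
      using a_pos b_pos h0_pos C_less by (simp add: field_simps)
    then have "real i * - (h0 / (N * a)) \<le> real i * ((a - b) * h0 / (N * a * b))"
      by (intro mult_left_mono) auto
    then show ?thesis using C_pos by (simp add: target_def)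
  qed
  then have "best i (C - 1) \<le> v (Suc i) C"
    using lb[of "C - 1"] C_pos by (intro best_le_value_at_capacity cv) simp
  then have "convex_value (Suc i)" using mid high ab by (intro convex_step cv) auto
  then show ?case using lb' ub' by blast
qed

lemma value_convex: "convex_value i"
  using convex_if_Station2_slower[of i] convex_if_Station2_faster[of i] by (cases "b \<le> a") auto

lemma collaborative_threshold:
  assumes "1 \<le> l" "l < N" "v i (Suc l) \<le> v i l"
  shows "v i l \<le> v i (l - 1)"
proof -
  have "slope i (l - 1) \<le> slope i (Suc (l - 1))"
    using value_convex[of i] assms unfolding convex_value_def by (metis One_nat_def Suc_pred less_le_trans zero_less_one)
  then show ?thesis using assms by (simp add: slope_def)
qed

end

section \<open>The value function with an empty queue\<close>

lemma clear_denominator: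
  fixes d :: real
  assumes "V = x / d + p / d * y + q / d * z" and "0 < d"
  shows "d * V = x + p * y + q * z"
  using assms by (simp add: field_simps)

text \<open>
  With an empty queue the stations work independently. The job in position \<open>m + 1\<close> at Station 2 waits
  for \<open>m + 1 - C2\<close> completions (truncated), each of mean \<open>1 / (C2 * mu2)\<close>, and is then served.
\<close>

lemma value_fn_empty_queue_closed_form:
  fixes C1 C2 :: nat and mu1 mu2 h0 h1 h2 :: real
  assumes pos: "1 \<le> C2" "0 < mu1" "0 < mu2" "0 < h0" "0 < h1" "0 < h2" "1 \<le> C1"
    and "k + l \<le> C1"
  shows "value_fn C2 mu1 mu2 h0 h1 h2 (0, k, l)
    = real k * h1 / mu1 + (\<Sum>m<l. h2 / mu2 * (1 + real (Suc m - C2) / real C2))"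
  using assms(8)
proof (induction "k + l" arbitrary: k l)
  case 0
  then show ?case using value_fn_empty[OF pos] by simp
next
  case (Suc n)
  define V where "V k l = value_fn C2 mu1 mu2 h0 h1 h2 (0, k, l)" for k l
  define w where "w m = h2 / mu2 * (1 + real (Suc m - C2) / real C2)" for m
  define d where "d = real k * mu1 + real (min l C2) * mu2"
  define F where "F = real k * h1 / mu1 + (\<Sum>m<l. w m)"
  have d: "0 < d"
  proof (cases "k = 0")
    case True
    then show ?thesis using Suc.hyps(2) pos by (simp add: d_def)
  next
    case False
    then have "0 < real k * mu1" using pos by simp
    moreover have "0 \<le> real (min l C2) * mu2" using pos by simp
    ultimately show ?thesis unfolding d_def by linarith
  qed
  have left: "real k * mu1 * V (k - 1) l = real k * mu1 * F - real k * h1"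
  proof (cases k)
    case (Suc j)
    have "V j l = real j * h1 / mu1 + (\<Sum>m<l. w m)"
      unfolding V_def w_def using Suc.hyps Suc.prems Suc by (intro Suc.hyps(1)) simp_all
    then have "V (k - 1) l = F - h1 / mu1" using Suc pos by (simp add: F_def field_simps)
    then have "real k * mu1 * V (k - 1) l = real k * mu1 * (F - h1 / mu1)" by simp
    also have "\<dots> = real k * mu1 * F - real k * h1" using pos by (simp add: right_diff_distrib)
    finally show ?thesis .
  qed simp
  have right: "real (min l C2) * mu2 * V k (l - 1) = real (min l C2) * mu2 * F - real l * h2"
  proof (cases l)
    case (Suc j)
    have "V k j = real k * h1 / mu1 + (\<Sum>m<j. w m)"
      unfolding V_def w_def using Suc.hyps Suc.prems Suc by (intro Suc.hyps(1)) simp_all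
    then have "real (min l C2) * mu2 * V k (l - 1)
        = real (min l C2) * mu2 * F - real (min l C2) * mu2 * w j"
      using Suc by (simp add: F_def right_diff_distrib[symmetric])
    moreover have "real (min l C2) * mu2 * w j = real l * h2"
      using Suc pos by (cases "l \<le> C2") (simp_all add: w_def of_nat_diff field_simps)
    ultimately show ?thesis by simp
  qed simp
  have "(0, k, l) \<in> state_space C1" using Suc.prems by (auto simp: state_space_def)
  moreover have "(k, l) \<noteq> (0, 0)" using Suc.hyps(2) by auto
  ultimately have "V k l = (real k * h1 + real l * h2) / d + real k * mu1 / d * V (k - 1) l
      + real (min l C2) * mu2 / d * V k (l - 1)"
    unfolding V_def d_def using value_fn_empty_queue[OF pos] by (simp add: service_rate_def)
  then have "d * V k l = real k * h1 + real l * h2 + real k * mu1 * V (k - 1) l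
      + real (min l C2) * mu2 * V k (l - 1)"
    using d by (rule clear_denominator)
  also have "\<dots> = d * F" unfolding left right by (simp add: d_def algebra_simps)
  finally have "V k l = F" using d by simp
  then show ?case by (simp add: V_def F_def w_def)
qed

lemma server_line_value_fn:
  fixes C1 C2 :: nat and mu1 mu2 h0 h1 h2 :: real
  assumes "1 \<le> C2" "C2 < C1" "0 < mu1" "0 < mu2" "0 < h0" "0 < h1" "0 < h2"
  shows "server_line C1 C2 mu1 mu2 h0 h1 h2
    (\<lambda>i l. value_fn C2 mu1 mu2 h0 h1 h2 (i, C1 - l, l))"
proof -
  note pos = assms(1,3-7)
  have C1: "1 \<le> C1" using assms by simp
  define V where "V i k l = value_fn C2 mu1 mu2 h0 h1 h2 (i, k, l)" for i k l
  have base: "V 0 (C1 - Suc l) (Suc l)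
      = V 0 (C1 - l) l + h2 / mu2 * (1 + real (Suc l - C2) / real C2) - h1 / mu1"
    if "l < C1" for l
  proof -
    have "real (C1 - l) = real (C1 - Suc l) + 1" using that by (simp add: of_nat_diff)
    then have "real (C1 - l) * h1 / mu1 = real (C1 - Suc l) * h1 / mu1 + h1 / mu1"
      by (simp only: distrib_right add_divide_distrib mult_1)
    moreover have "V 0 (C1 - l) l = real (C1 - l) * h1 / mu1
        + (\<Sum>m<l. h2 / mu2 * (1 + real (Suc m - C2) / real C2))"
      "V 0 (C1 - Suc l) (Suc l) = real (C1 - Suc l) * h1 / mu1
        + (\<Sum>m<Suc l. h2 / mu2 * (1 + real (Suc m - C2) / real C2))"
      unfolding V_def using that by (intro value_fn_empty_queue_closed_form[OF pos C1]; simp)+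
    ultimately show ?thesis by (simp only: sum.lessThan_Suc)
  qed
  have queue: "(real (C1 - l) * mu1 + real (min l C2) * mu2) * V (Suc i) (C1 - l) l
      = real (Suc i) * h0 + real (C1 - l) * h1 + real l * h2
        + real (C1 - l) * mu1 * min (V i (C1 - l) l) (V i (C1 - Suc l) (Suc l))
        + real (min l C2) * mu2 * min (V i (C1 - (l - 1)) (l - 1)) (V i (C1 - l) l)"
    if l: "l \<le> C1" for i l
  proof -
    define d where "d = real (C1 - l) * mu1 + real (min l C2) * mu2"
    have d: "0 < d"
    proof (cases "l = C1")
      case True
      then show ?thesis using assms by (simp add: d_def)
    next
      case False
      then have "0 < real (C1 - l) * mu1" using l pos by simp
      moreover have "0 \<le> real (min l C2) * mu2" using pos by simp
      ultimately show ?thesis unfolding d_def by linarith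
    qed
    have "(Suc i, C1 - l, l) \<in> state_space C1" using l by (simp add: state_space_def)
    then have "V (Suc i) (C1 - l) l = (real (Suc i) * h0 + real (C1 - l) * h1 + real l * h2) / d
      + real (C1 - l) * mu1 / d * min (V i (C1 - l) l) (V i (C1 - Suc l) (Suc l))
      + real (min l C2) * mu2 / d * min (V i (C1 - l + 1) (l - 1)) (V i (C1 - l) l)"
      unfolding V_def d_def using value_fn_queue[OF pos C1, of "Suc i" "C1 - l" l]
      by (simp add: service_rate_def)
    then have "d * V (Suc i) (C1 - l) l = real (Suc i) * h0 + real (C1 - l) * h1 + real l * h2
      + real (C1 - l) * mu1 * min (V i (C1 - l) l) (V i (C1 - Suc l) (Suc l))
      + real (min l C2) * mu2 * min (V i (C1 - l + 1) (l - 1)) (V i (C1 - l) l)"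
      using d by (rule clear_denominator)
    moreover have "real (min l C2) * mu2 * min (V i (C1 - l + 1) (l - 1)) (V i (C1 - l) l)
      = real (min l C2) * mu2 * min (V i (C1 - (l - 1)) (l - 1)) (V i (C1 - l) l)"
      using l by (cases l) (simp_all add: Suc_diff_Suc Suc_diff_le)
    ultimately show ?thesis unfolding d_def by simp
  qed
  show ?thesis
    by unfold_locales (use assms base queue in \<open>simp_all add: V_def\<close>)
qed

section \<open>Monotonicity of the optimal decision\<close>

lemma collaborative_optimal_iff:
  "optimal_decision C2 mu1 mu2 h0 h1 h2 s f Collaborative
    \<longleftrightarrow> value_fn C2 mu1 mu2 h0 h1 h2 (next_state s f Collaborative)
      \<le> value_fn C2 mu1 mu2 h0 h1 h2 (next_state s f Independent)"
  by (auto simp: optimal_decision_def min_def)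

theorem theorem3p3:
  fixes C1 C2 :: nat and mu1 mu2 h0 h1 h2 :: real and i k l :: nat
  assumes "C1 \<ge> 1" and "C2 \<ge> 1" and "C2 < C1"
    and "mu1 > 0" and "mu2 > 0"
    and "h0 > 0" and "h1 > 0" and "h2 > 0"
    and "(i, k, l) \<in> state_space C1"
    and "l \<ge> 1" and "(i, k + 1, l - 1) \<in> state_space C1"
    and "i \<ge> 1"
  shows "(k \<ge> 1 \<and> optimal_decision C2 mu1 mu2 h0 h1 h2 (i, k, l) Station1 Collaborative
            \<longrightarrow> optimal_decision C2 mu1 mu2 h0 h1 h2 (i, k + 1, l - 1) Station1 Collaborative)
       \<and> (l - 1 \<ge> 1 \<and> optimal_decision C2 mu1 mu2 h0 h1 h2 (i, k, l) Station2 Collaborative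
            \<longrightarrow> optimal_decision C2 mu1 mu2 h0 h1 h2 (i, k + 1, l - 1) Station2 Collaborative)"
proof -
  interpret server_line C1 C2 mu1 mu2 h0 h1 h2
    "\<lambda>i l. value_fn C2 mu1 mu2 h0 h1 h2 (i, C1 - l, l)"
    using assms by (intro server_line_value_fn) auto
  obtain j where i: "i = Suc j" using assms(12) by (cases i) auto
  obtain m where l: "l = Suc m" using assms(10) by (cases l) auto
  have k: "k = C1 - l" "l \<le> C1" using assms(9) i by (auto simp: state_space_def)
  have "optimal_decision C2 mu1 mu2 h0 h1 h2 (i, k + 1, l - 1) Station1 Collaborative"
    if "k \<ge> 1" "optimal_decision C2 mu1 mu2 h0 h1 h2 (i, k, l) Station1 Collaborative"
  proof -
    have "k - 1 = C1 - Suc l" "k + 1 = C1 - m" using k l that by auto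
    then show ?thesis using that collaborative_threshold[of l j] k
      by (simp add: collaborative_optimal_iff i l)
  qed
  moreover have "optimal_decision C2 mu1 mu2 h0 h1 h2 (i, k + 1, l - 1) Station2 Collaborative"
    if l1: "l - 1 \<ge> 1" and opt: "optimal_decision C2 mu1 mu2 h0 h1 h2 (i, k, l) Station2 Collaborative"
  proof -
    obtain p where m: "m = Suc p" using l1 l by (cases m) auto
    have "k + 1 = C1 - m" "k + 2 = C1 - p" using k l m by auto
    then show ?thesis using opt collaborative_threshold[of m j] k
      by (simp add: collaborative_optimal_iff i l m)
  qed
  ultimately show ?thesis by blast
qed

end
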